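(* Let $x$ be a squarefree positive integer with $x\equiv 3 \pmod{4}$, and let $a=4x$. If $n$ is an odd positive integer, then $a^{nx}+1$ is not the sum of two squares.
   Context: An integer $N$ is "the sum of two squares" if $N = s^2+t^2$ for some integers $s,t$ (zero is allowed). *)

theory Defs
  imports "HOL-Number_Theory.Number_Theory" "HOL-Computational_Algebra.Squarefree"
begin

definition sum_of_two_squares :: "int \<Rightarrow> bool" where
  "sum_of_two_squares N \<longleftrightarrow> (\<exists>s t :: int. N = s\<^sup>2 + t\<^sup>2)"

end

theory Submission
  imports Defs "Jordan_Normal_Form.Char_Poly"
begin

text \<open>
  Write \<open>y = (-4x)\<^sup>x\<close>. Since \<open>x\<close> and \<open>n\<close> are odd, the number in question is
  \<open>N = (4x)\<^bsup>nx\<^esup> + 1 = 1 - y\<^sup>n\<close>. The proof exhibits a positive divisor \<open>d\<close> of \<open>N\<close> that is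
  coprime to \<open>N/d\<close> and congruent to 3 modulo 4. No sum of two squares has such a divisor: \<open>d\<close> has a
  prime factor \<open>q\<close> that is 3 modulo 4, such a prime divides a sum of two squares to an even power,
  and all of that power sits in \<open>d\<close>, so the factors \<open>q\<^sup>2\<close> can be removed one by one
  (\<open>unitary_divisor_of_sum_of_squares\<close>).

  The divisor comes from an Aurifeuillian factorization. Let \<open>\<chi>\<close> be the Jacobi symbol modulo \<open>x\<close>
  and \<open>\<zeta>\<close> a primitive \<open>x\<close>-th root of unity. Because \<open>x\<close> is squarefree and 3 modulo 4, the Gauss sum
  \<open>\<gamma>(k) = \<Sum>\<^sub>j \<chi>(j) \<zeta>\<^bsup>jk\<^esup>\<close> satisfies \<open>\<gamma>(k)\<^sup>2 = -x\<close> for \<open>k\<close> coprime to \<open>x\<close>, and it vanishes for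
  all other \<open>k\<close> (\<open>gauss_sum_square\<close>, \<open>gauss_sum_not_coprime\<close>). So \<open>\<lambda>\<^sub>k = \<zeta>\<^sup>k \<gamma>(k)\<close> is either zero or a
  square root of \<open>-x \<zeta>\<^bsup>2k\<^esup>\<close>. In an indeterminate \<open>s\<close> put \<open>Y = -x s\<^sup>2\<close>. Then
  \<open>1 - Y\<^sup>x = \<Prod>\<^sub>k (1 - \<zeta>\<^bsup>2k\<^esup> Y)\<close>, and for \<open>k\<close> coprime to \<open>x\<close> the \<open>k\<close>-th factor is
  \<open>(1 - s \<lambda>\<^sub>k) (1 + s \<lambda>\<^sub>k)\<close>. The numbers \<open>\<lambda>\<^sub>k\<close> are the eigenvalues of an integer circulant matrix with
  entries \<open>\<chi>(j - i - 1)\<close>, so that \<open>\<Prod>\<^sub>k (1 - s \<lambda>\<^sub>k)\<close> has integer coefficients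
  (\<open>ex_int_poly_lam\<close>). Its coefficient of \<open>s\<close> is \<open>x\<close>, an odd number, and therefore its value at
  \<open>s = 2\<close>, where \<open>Y\<^sup>x\<close> becomes \<open>y\<close>, is congruent to \<open>1 + 2x\<close>, that is to 3, modulo 4. It is positive
  since the polynomial divides one without real roots. Being coprime to the complementary factor is
  a matter of derivatives: a common prime factor of two cofactors of \<open>1 - Y\<^sup>m\<close> at \<open>s = 2\<close> divides the
  derivative, hence divides \<open>m\<close> (\<open>common_prime_factor\<close>).

  If every prime factor of \<open>n\<close> divides \<open>x\<close>, this divisor of \<open>1 - y\<close> remains coprime to its cofactor
  in \<open>1 - y\<^sup>n\<close>. Otherwise let \<open>p\<close> be the largest prime factor of \<open>n\<close> that does not divide \<open>x\<close>. Now
  \<open>1 + y + \<dots> + y\<^bsup>p-1\<^esup>\<close> replaces \<open>1 - y\<close>. It has the two divisors that are the values at \<open>s = 2\<close> and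
  at \<open>s = -2\<close> of \<open>\<Prod>\<^sub>k (1 + s \<lambda>\<^sub>k + \<dots> + (s \<lambda>\<^sub>k)\<^bsup>p-1\<^esup>)\<close> (\<open>factor_geometric_sum\<close>), and both are 3 modulo 4.
  Their product is not divisible by \<open>p\<^sup>2\<close>, so one of them is prime to \<open>p\<close>; that one is the divisor
  \<open>d\<close>. A prime \<open>q\<close> dividing both \<open>d\<close> and \<open>N/d\<close> would have to divide \<open>n\<close>, hence be less than \<open>p\<close>, while
  \<open>y\<close> has order \<open>p\<close> modulo \<open>q\<close>, which Fermat's theorem forbids.
\<close>

section \<open>Legendre symbols\<close>

lemma eq_if_cong_in_signs:
  fixes u v :: int
  assumes "[u = v] (mod int p)" "p > 2" "u \<in> {-1, 0, 1}" "v \<in> {-1, 0, 1}"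
  shows "u = v"
proof -
  have "int p dvd u - v" using assms(1) by (simp add: cong_iff_dvd_diff)
  moreover have "\<bar>u - v\<bar> < int p" using assms(2-4) by auto
  ultimately show ?thesis using dvd_imp_le_int[of "u - v" "int p"] by fastforce
qed

lemma Legendre_in_signs: "Legendre a p \<in> {-1, 0, 1}"
  by (auto simp: Legendre_def)

lemma Legendre_eq_0_iff: "Legendre a p = 0 \<longleftrightarrow> p dvd a"
  by (auto simp: Legendre_def cong_0_iff)

lemma Legendre_mult:
  assumes "prime p" "p > 2"
  shows "Legendre (a * b) (int p) = Legendre a (int p) * Legendre b (int p)"
proof (rule eq_if_cong_in_signs[OF _ assms(2) Legendre_in_signs])
  let ?h = "(p - 1) div 2"
  have "[Legendre (a * b) (int p) = (a * b) ^ ?h] (mod int p)"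
    by (rule euler_criterion[OF assms])
  also have "(a * b) ^ ?h = a ^ ?h * b ^ ?h" by (simp add: power_mult_distrib)
  also have "[\<dots> = Legendre a (int p) * Legendre b (int p)] (mod int p)"
    by (intro cong_mult cong_sym[OF euler_criterion] assms)
  finally show "[Legendre (a * b) (int p) = Legendre a (int p) * Legendre b (int p)] (mod int p)" .
  show "Legendre a (int p) * Legendre b (int p) \<in> {-1, 0, 1}"
    using Legendre_in_signs[of a "int p"] Legendre_in_signs[of b "int p"] by auto
qed

lemma Legendre_cong:
  assumes "[a = b] (mod p)"
  shows "Legendre a p = Legendre b p"
proof -
  have "[y = a] (mod p) \<longleftrightarrow> [y = b] (mod p)" for y
    using assms cong_sym cong_trans by blast
  then show ?thesis using assms
    by (auto simp: Legendre_def QuadRes_def dest: cong_trans cong_sym)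
qed

lemma Legendre_1:
  assumes "prime p"
  shows "Legendre 1 (int p) = 1"
proof -
  have "QuadRes (int p) 1" unfolding QuadRes_def by (rule exI[of _ 1]) simp
  moreover have "\<not> int p dvd 1" using assms by (simp add: prime_nat_iff)
  ultimately show ?thesis by (simp add: Legendre_def cong_0_iff)
qed

lemma Legendre_minus_1_cong:
  assumes "prime p" "p > 2"
  shows "[Legendre (-1) (int p) = int p] (mod 4)"
proof -
  have odd: "odd p" using assms prime_odd_nat by blast
  have "Legendre (-1) (int p) = (-1) ^ ((p - 1) div 2)"
  proof (rule eq_if_cong_in_signs[OF euler_criterion assms(2) Legendre_in_signs])
    show "(-1::int) ^ ((p - 1) div 2) \<in> {-1, 0, 1}"
      by (cases "even ((p - 1) div 2)") auto
  qed (use assms in auto)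
  moreover have "p mod 4 = 1 \<or> p mod 4 = 3" using odd by presburger
  then have "[(-1) ^ ((p - 1) div 2) = int p] (mod 4)"
  proof
    assume "p mod 4 = 1"
    then have "even ((p - 1) div 2)" "int p mod 4 = 1" by presburger+
    then show ?thesis by (simp add: cong_def)
  next
    assume "p mod 4 = 3"
    then have "odd ((p - 1) div 2)" "int p mod 4 = 3" by presburger+
    then show ?thesis by (simp add: cong_def)
  qed
  ultimately show ?thesis by simp
qed

text \<open>A primitive root is not a square, for its power with exponent \<open>(p - 1)/2\<close>
  is not 1.\<close>

lemma exists_nonresidue:
  assumes "prime p" "p > 2"
  shows "\<exists>c. Legendre c (int p) = -1"
proof -
  obtain g where g: "residue_primroot p g"
    using prime_primitive_root_exists[OF prime_gt_1_nat[OF assms(1)] assms(1)] by blast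
  then have ord: "ord p g = p - 1" and cop: "coprime p g"
    by (auto simp: residue_primroot_def totient_prime assms)
  have "odd p" using assms prime_odd_nat by blast
  then have h: "0 < (p - 1) div 2" "(p - 1) div 2 < ord p g" using assms(2) ord by auto
  have "\<not> [g ^ ((p - 1) div 2) = 1] (mod p)" using ord_minimal[OF h] .
  then have "\<not> [int g ^ ((p - 1) div 2) = 1] (mod int p)"
    by (metis cong_int_iff of_nat_1 of_nat_power)
  then have "Legendre (int g) (int p) \<noteq> 1"
    using euler_criterion[OF assms, of "int g"] by (auto dest: cong_sym)
  moreover have "\<not> p dvd g" using cop assms(1)
    by (meson coprime_absorb_left not_prime_unit)
  then have "Legendre (int g) (int p) \<noteq> 0" by (simp add: Legendre_eq_0_iff)
  ultimately show ?thesis using Legendre_in_signs[of "int g" "int p"] by blast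
qed

lemma fermat_int:
  fixes y :: int
  assumes "prime p" "p > 2" "\<not> int p dvd y"
  shows "[y ^ (p - 1) = 1] (mod int p)"
proof -
  have "even (p - 1)" using assms(1,2) prime_odd_nat[of p] by simp
  then have "y ^ (p - 1) = (y ^ ((p - 1) div 2)) ^ 2" by (simp flip: power_mult)
  also have "[\<dots> = (Legendre y (int p)) ^ 2] (mod int p)"
    by (intro cong_pow cong_sym[OF euler_criterion] assms)
  also have "(Legendre y (int p)) ^ 2 = 1"
    using assms(3) by (auto simp: Legendre_def cong_0_iff)
  finally show ?thesis .
qed

section \<open>Unitary divisors of sums of two squares\<close>

lemma prime_3_mod_4_dvd_sum_of_squares:
  fixes s t :: int
  assumes q: "prime q" "q mod 4 = 3" and dvd: "int q dvd s\<^sup>2 + t\<^sup>2"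
  shows "int q dvd s"
proof (rule ccontr)
  assume "\<not> int q dvd s"
  moreover have pq: "prime (int q)" using q(1) by simp
  ultimately have "coprime s (int q)" using prime_imp_coprime coprime_commute by blast
  then obtain u where u: "[s * u = 1] (mod int q)" using cong_solve_coprime_int by blast
  have "q > 2" using q prime_ge_2_nat[of q] by (cases "q = 2") auto
  have "[s\<^sup>2 + t\<^sup>2 = 0] (mod int q)" using dvd by (simp add: cong_0_iff)
  then have "[(s\<^sup>2 + t\<^sup>2) * u\<^sup>2 - (s * u)\<^sup>2 = 0 * u\<^sup>2 - 1\<^sup>2] (mod int q)"
    using u by (intro cong_diff cong_mult cong_pow) auto
  moreover have "(s\<^sup>2 + t\<^sup>2) * u\<^sup>2 - (s * u)\<^sup>2 = (t * u)\<^sup>2"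
    by (simp add: algebra_simps power_mult_distrib)
  ultimately have "[(t * u)\<^sup>2 = -1] (mod int q)" by simp
  then have "QuadRes (int q) (-1)" unfolding QuadRes_def by blast
  moreover have "\<not> int q dvd -1" using \<open>q > 2\<close> by simp
  ultimately have "Legendre (-1) (int q) = 1" by (simp add: Legendre_def cong_0_iff)
  then have "[1 = int q] (mod 4)" using Legendre_minus_1_cong[OF q(1) \<open>q > 2\<close>] by simp
  moreover have "int q mod 4 = 3" using q(2) by presburger
  ultimately show False by (simp add: cong_def)
qed

lemma exists_prime_factor_3_mod_4:
  fixes d :: nat
  assumes "d mod 4 = 3"
  shows "\<exists>q. prime q \<and> q mod 4 = 3 \<and> q dvd d"
  using assms
proof (induct d rule: less_induct)
  case (less d)
  have "d \<noteq> 1" using less.prems by auto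
  then obtain p where p: "prime p" "p dvd d" using prime_factor_nat by blast
  then obtain e where e: "d = p * e" by blast
  show ?case
  proof (cases "p mod 4 = 3")
    case False
    have "odd d" using less.prems by presburger
    then have "odd p" using p(2) by auto
    then have p4: "p mod 4 = 1" using False by presburger
    have "d mod 4 = (p mod 4) * (e mod 4) mod 4" unfolding e by (simp add: mod_mult_eq)
    then have "e mod 4 = 3" using p4 less.prems by simp
    moreover have "e > 0" "p > 1" using e less.prems prime_gt_1_nat[OF p(1)] by (auto intro: gr0I)
    then have "e < d" using e by simp
    ultimately obtain q where "prime q" "q mod 4 = 3" "q dvd e" using less.hyps by blast
    then show ?thesis using e by auto
  qed (use p in blast)
qed

text \<open>Descent: a prime \<open>q\<close> that is 3 modulo 4 and divides \<open>d\<close> divides both \<open>s\<close> and \<open>t\<close>. As it does not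
  divide \<open>k\<close>, the square of \<open>q\<close> divides \<open>d\<close>, and cancelling it keeps all hypotheses and the residue
  of \<open>d\<close> modulo 4.\<close>

lemma unitary_divisor_of_sum_of_squares:
  fixes d k s t :: int
  assumes "d * k = s\<^sup>2 + t\<^sup>2" "coprime d k" "d > 0"
  shows "d mod 4 \<noteq> 3"
  using assms
proof (induct "nat d" arbitrary: d s t rule: less_induct)
  case less
  show ?case
  proof
    assume d3: "d mod 4 = 3"
    have "int (nat d mod 4) = int 3" using d3 less.prems(3) by (simp add: zmod_int)
    then have "nat d mod 4 = 3" by (simp only: of_nat_eq_iff)
    then obtain q where q: "prime q" "q mod 4 = 3" "q dvd nat d"
      using exists_prime_factor_3_mod_4 by blast
    have "int q dvd int (nat d)" using q(3) by (simp only: int_dvd_int_iff)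
    then have qd: "int q dvd d" using less.prems(3) by simp
    then have "int q dvd s\<^sup>2 + t\<^sup>2" unfolding less.prems(1)[symmetric] by (rule dvd_mult2)
    then have "int q dvd s\<^sup>2 + t\<^sup>2" "int q dvd t\<^sup>2 + s\<^sup>2" by (simp_all only: add.commute)
    then have "int q dvd s" "int q dvd t"
      using prime_3_mod_4_dvd_sum_of_squares[OF q(1,2)] by blast+
    then obtain s' t' where st: "s = int q * s'" "t = int q * t'" by (elim dvdE)
    have "(int q)\<^sup>2 dvd d * k"
      unfolding less.prems(1) st by (simp add: power_mult_distrib)
    moreover have "coprime (int q) k" by (rule coprime_divisors[OF qd dvd_refl less.prems(2)])
    then have "coprime ((int q)\<^sup>2) k" by simp
    ultimately have "(int q)\<^sup>2 dvd d" using coprime_dvd_mult_left_iff by blast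
    then obtain d' where d': "d = (int q)\<^sup>2 * d'" by blast
    have q0: "int q > 1" using prime_gt_1_nat[OF q(1)] by simp
    have "d' > 0" using less.prems(3) unfolding d' by (simp add: zero_less_mult_iff)
    have "1 * d' < (int q)\<^sup>2 * d'"
      using q0 \<open>d' > 0\<close> by (intro mult_strict_right_mono one_less_power) simp_all
    then have "d' < d" unfolding d' by (simp only: mult_1)
    then have "nat d' < nat d" using less.prems(3) by simp
    have "(int q)\<^sup>2 * (d' * k) = (int q)\<^sup>2 * (s'\<^sup>2 + t'\<^sup>2)"
      using less.prems(1) unfolding d' st by (simp add: algebra_simps power_mult_distrib)
    then have "d' * k = s'\<^sup>2 + t'\<^sup>2" using q0 by simp
    moreover have "coprime d' k" using less.prems(2) unfolding d' by simp
    ultimately have "d' mod 4 \<noteq> 3" using less.hyps \<open>nat d' < nat d\<close> \<open>d' > 0\<close> by blast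
    have "int q mod 4 = 3" using q(2) by presburger
    then have "[int q = 3] (mod 4)" by (simp add: cong_def)
    then have "[d = 3\<^sup>2 * d'] (mod 4)" unfolding d' by (intro cong_mult cong_pow cong_refl)
    moreover have "9 * d' mod 4 = d' mod 4" by presburger
    ultimately have d4: "d mod 4 = d' mod 4" by (simp add: cong_def)
    with \<open>d' mod 4 \<noteq> 3\<close> show False using d3 by simp
  qed
qed

section \<open>The Jacobi symbol of a squarefree modulus\<close>

lemma bij_betw_affine_mod:
  fixes x :: nat and c d :: int
  assumes "x > 0" "coprime c (int x)"
  shows "bij_betw (\<lambda>j. nat ((c * int j + d) mod int x)) {..<x} {..<x}"
proof -
  let ?f = "\<lambda>j. nat ((c * int j + d) mod int x)"
  have lt: "?f j < x" for j using assms(1) by (simp add: nat_less_iff)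
  have "inj_on ?f {..<x}"
  proof (rule inj_onI)
    fix i j assume ij: "i \<in> {..<x}" "j \<in> {..<x}" "?f i = ?f j"
    then have "[c * int i + d = c * int j + d] (mod int x)"
      using assms(1) by (simp add: cong_def eq_nat_nat_iff)
    then have "[c * int i = c * int j] (mod int x)" by (simp add: cong_add_rcancel)
    then have "[int i = int j] (mod int x)" using assms(2) cong_mult_lcancel by blast
    then show "i = j" using ij by (simp add: cong_int_iff cong_def)
  qed
  moreover from this have "?f ` {..<x} = {..<x}"
    using lt by (intro endo_inj_surj) auto
  ultimately show ?thesis by (simp add: bij_betw_def)
qed

text \<open>Sums and products over a complete residue system may be shifted and scaled. The summation
  index is a natural number while the function lives on the integers, because shifts lead to
  negative arguments.\<close>

lemma
  fixes f :: "int \<Rightarrow> 'a :: comm_semiring_1"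
  assumes "x > 0" "coprime c (int x)" and periodic: "\<And>k. f (k mod int x) = f k"
  shows sum_affine_reindex: "(\<Sum>j<x. f (c * int j + d)) = (\<Sum>j<x. f (int j))"
    and prod_affine_reindex: "(\<Prod>j<x. f (c * int j + d)) = (\<Prod>j<x. f (int j))"
proof -
  have f: "f (int (nat ((c * int j + d) mod int x))) = f (c * int j + d)" for j
    using periodic[of "c * int j + d"] assms(1) by simp
  show "(\<Sum>j<x. f (c * int j + d)) = (\<Sum>j<x. f (int j))"
    using sum.reindex_bij_betw[OF bij_betw_affine_mod[OF assms(1,2), of d], of "\<lambda>j. f (int j)"]
    unfolding f .
  show "(\<Prod>j<x. f (c * int j + d)) = (\<Prod>j<x. f (int j))"
    using prod.reindex_bij_betw[OF bij_betw_affine_mod[OF assms(1,2), of d], of "\<lambda>j. f (int j)"]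
    unfolding f .
qed

locale aurifeuillian_modulus =
  fixes x :: nat
  assumes squarefree_x: "squarefree x" and x_mod_4: "x mod 4 = 3"
begin

lemma x_ge_3: "x \<ge> 3" and odd_x: "odd x"
  using x_mod_4 by presburger+

lemma x_pos: "x > 0" using x_ge_3 by simp

lemma prime_factor_gt_2:
  assumes "p \<in> prime_factors x"
  shows "prime p" "p > 2" "p dvd x"
proof -
  show "prime p" and dvd: "p dvd x" using assms by (auto simp: prime_factors_dvd)
  then have "p \<noteq> 2" using odd_x by auto
  then show "p > 2" using \<open>prime p\<close> prime_ge_2_nat[of p] by simp
qed

lemma prod_prime_factors_x: "(\<Prod>p\<in>prime_factors x. p) = x"
proof -
  have "(\<Prod>p\<in>prime_factors x. p) = (\<Prod>p\<in>prime_factors x. p ^ multiplicity p x)"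
  proof (rule prod.cong[OF refl])
    fix p assume p: "p \<in> prime_factors x"
    then have "multiplicity p x > 0"
      using x_pos by (auto simp: prime_factors_multiplicity)
    moreover have "\<forall>q. prime q \<longrightarrow> multiplicity q x \<le> 1"
      using squarefree_x squarefree_factorial_semiring''[of x] x_pos by blast
    then have "multiplicity p x \<le> 1" using prime_factor_gt_2(1)[OF p] by blast
    ultimately have "multiplicity p x = 1" by linarith
    then show "p = p ^ multiplicity p x" by simp
  qed
  also have "\<dots> = x" using x_pos prod_prime_factors[of x] by simp
  finally show ?thesis .
qed

definition jacobi :: "int \<Rightarrow> int" where
  "jacobi k = (\<Prod>p\<in>prime_factors x. Legendre k (int p))"

lemma jacobi_cong:
  assumes "[a = b] (mod int x)"
  shows "jacobi a = jacobi b"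
  unfolding jacobi_def
proof (rule prod.cong[OF refl])
  fix p assume "p \<in> prime_factors x"
  then have "int p dvd int x" using prime_factor_gt_2(3) by simp
  then show "Legendre a (int p) = Legendre b (int p)"
    using Legendre_cong cong_dvd_modulus[OF assms] by blast
qed

lemma jacobi_mod [simp]: "jacobi (k mod int x) = jacobi k"
  by (rule jacobi_cong) (simp add: cong_def)

lemma jacobi_mult: "jacobi (a * b) = jacobi a * jacobi b"
  unfolding jacobi_def prod.distrib[symmetric]
  by (rule prod.cong[OF refl]) (simp add: Legendre_mult prime_factor_gt_2)

lemma jacobi_1: "jacobi 1 = 1"
  unfolding jacobi_def by (rule prod.neutral) (simp add: Legendre_1 prime_factor_gt_2)

lemma jacobi_eq_0_iff: "jacobi k = 0 \<longleftrightarrow> \<not> coprime k (int x)"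
proof -
  have "jacobi k = 0 \<longleftrightarrow> (\<exists>p\<in>prime_factors x. int p dvd k)"
    unfolding jacobi_def by (simp add: Legendre_eq_0_iff)
  also have "\<dots> \<longleftrightarrow> \<not> coprime k (int x)"
  proof
    assume "\<exists>p\<in>prime_factors x. int p dvd k"
    then obtain p where p: "p \<in> prime_factors x" "int p dvd k" by blast
    then have "\<not> is_unit (int p)" "int p dvd int x"
      using prime_factor_gt_2[OF p(1)] by auto
    then show "\<not> coprime k (int x)" using not_coprimeI[OF p(2)] by blast
  next
    assume "\<not> coprime k (int x)"
    then have "\<not> is_unit (gcd k (int x))" by (simp only: is_unit_gcd not_False_eq_True)
    moreover have "gcd k (int x) \<noteq> 0" using x_pos by simp
    ultimately obtain q where q: "prime q" "q dvd gcd k (int x)"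
      using prime_divisor_exists by blast
    define p where "p = nat q"
    have qp: "q = int p" using q(1) by (simp add: p_def prime_ge_0_int)
    have "prime p" "int p dvd k" "p dvd x" using q unfolding qp by auto
    then have "p \<in> prime_factors x" using x_pos by (simp add: prime_factors_dvd)
    then show "\<exists>p\<in>prime_factors x. int p dvd k" using \<open>int p dvd k\<close> by blast
  qed
  finally show ?thesis .
qed

lemma jacobi_in_signs: "jacobi k \<in> {-1, 0, 1}"
proof -
  have "(\<Prod>p\<in>A. Legendre k (int p)) \<in> {-1, 0, 1}" for A :: "nat set"
  proof (induct A rule: infinite_finite_induct)
    case (insert p A)
    then show ?case using Legendre_in_signs[of k "int p"] by auto
  qed auto
  then show ?thesis by (simp only: jacobi_def)
qed

lemma jacobi_square: "(jacobi k)\<^sup>2 = (if coprime k (int x) then 1 else 0)"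
  using jacobi_in_signs[of k] jacobi_eq_0_iff[of k] by auto

text \<open>Modulo 4, each factor of the symbol at \<open>-1\<close> agrees with the corresponding prime, hence the
  product agrees with \<open>x\<close>. This is where the residue of \<open>x\<close> modulo 4 decides the sign.\<close>

lemma jacobi_minus_1: "jacobi (-1) = -1"
proof -
  have "[jacobi (-1) = (\<Prod>p\<in>prime_factors x. int p)] (mod 4)"
    unfolding jacobi_def by (rule cong_prod) (simp add: Legendre_minus_1_cong prime_factor_gt_2)
  also have "(\<Prod>p\<in>prime_factors x. int p) = int x"
    by (simp add: prod_prime_factors_x flip: of_nat_prod)
  finally have "[jacobi (-1) = int x] (mod 4)" .
  moreover have "int x mod 4 = 3" using x_mod_4 by presburger
  moreover have "(jacobi (-1))\<^sup>2 = 1" using jacobi_square[of "-1"] by simp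
  then have "jacobi (-1) = 1 \<or> jacobi (-1) = -1" by (simp add: power2_eq_1_iff)
  ultimately show ?thesis by (auto simp: cong_def)
qed

section \<open>Gauss sums\<close>

definition zeta_pow :: "int \<Rightarrow> complex" where
  "zeta_pow k = cis (2 * pi * of_int k / real x)"

lemma zeta_pow_0 [simp]: "zeta_pow 0 = 1"
  by (simp add: zeta_pow_def)

lemma zeta_pow_add: "zeta_pow (j + k) = zeta_pow j * zeta_pow k"
  by (simp add: zeta_pow_def cis_mult ring_distribs add_divide_distrib)

lemma zeta_pow_x_mult: "zeta_pow (int x * k) = 1"
proof -
  have "2 * pi * of_int (int x * k) / real x = 2 * pi * of_int k" using x_pos by simp
  then show ?thesis by (simp add: zeta_pow_def)
qed

lemma zeta_pow_cong: "[j = k] (mod int x) \<Longrightarrow> zeta_pow j = zeta_pow k"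
proof -
  assume "[j = k] (mod int x)"
  then obtain m where "j = int x * m + k"
    by (metis cong_iff_lin add.commute cong_sym)
  then show ?thesis by (simp add: zeta_pow_add zeta_pow_x_mult)
qed

lemma zeta_pow_mod [simp]: "zeta_pow (k mod int x) = zeta_pow k"
  by (rule zeta_pow_cong) (simp add: cong_def)

lemma zeta_pow_power: "zeta_pow k ^ m = zeta_pow (int m * k)"
  by (induct m) (simp_all add: zeta_pow_add ring_distribs)

lemma zeta_pow_eq_1_iff: "zeta_pow k = 1 \<longleftrightarrow> int x dvd k"
proof
  assume "zeta_pow k = 1"
  then have "cos (2 * pi * of_int k / real x) = 1" by (simp add: zeta_pow_def complex_eq_iff)
  then obtain m :: int where "2 * pi * of_int k / real x = of_int m * 2 * pi"
    using cos_one_2pi_int by blast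
  then have "of_int k = real x * of_int m" using x_pos by (simp add: field_simps)
  then have "real_of_int k = real_of_int (int x * m)" by simp
  then have "k = int x * m" by (simp only: of_int_eq_iff)
  then show "int x dvd k" by simp
next
  assume "int x dvd k"
  then show "zeta_pow k = 1" using zeta_pow_x_mult by auto
qed

lemma sum_zeta_pow: "(\<Sum>j<x. zeta_pow (int j * k)) = (if int x dvd k then of_nat x else 0)"
proof -
  have eq: "(\<Sum>j<x. zeta_pow (int j * k)) = (\<Sum>j<x. zeta_pow k ^ j)" by (simp add: zeta_pow_power)
  show ?thesis
  proof (cases "int x dvd k")
    case True
    then have "zeta_pow k = 1" by (simp add: zeta_pow_eq_1_iff)
    then show ?thesis using True eq by simp
  next
    case False
    then have "zeta_pow k \<noteq> 1" by (simp add: zeta_pow_eq_1_iff)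
    moreover have "zeta_pow k ^ x = 1" by (simp add: zeta_pow_power zeta_pow_x_mult)
    ultimately show ?thesis using False eq by (simp add: geometric_sum)
  qed
qed

definition gauss_sum :: "int \<Rightarrow> complex" where
  "gauss_sum k = (\<Sum>j<x. of_int (jacobi (int j)) * zeta_pow (int j * k))"

lemma gauss_sum_scale:
  assumes "coprime c (int x)"
  shows "gauss_sum k = of_int (jacobi c) * gauss_sum (c * k)"
proof -
  let ?f = "\<lambda>j. of_int (jacobi j) * zeta_pow (j * k)"
  have per: "?f (j mod int x) = ?f j" for j
    by (metis jacobi_mod mod_mult_left_eq zeta_pow_mod)
  have "gauss_sum k = (\<Sum>j<x. ?f (c * int j + 0))"
    unfolding gauss_sum_def using sum_affine_reindex[of x c ?f 0, OF x_pos assms per] by simp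
  also have "\<dots> = of_int (jacobi c) * gauss_sum (c * k)"
    by (simp add: gauss_sum_def jacobi_mult sum_distrib_left mult_ac)
  finally show ?thesis .
qed

text \<open>The character is primitive. If a prime \<open>p\<close> divides \<open>k\<close> and \<open>x\<close>, scale the summation index by
  some \<open>c\<close> that is 1 modulo \<open>x/p\<close> and a nonresidue modulo \<open>p\<close>: the roots of unity do not
  change, but the character changes its sign, so the sum equals its own negative.\<close>

lemma gauss_sum_not_coprime:
  assumes "\<not> coprime k (int x)"
  shows "gauss_sum k = 0"
proof -
  have "jacobi k = 0" using assms jacobi_eq_0_iff by simp
  then obtain p where p: "p \<in> prime_factors x" "int p dvd k"
    by (auto simp: jacobi_def Legendre_eq_0_iff)
  note p' = prime_factor_gt_2[OF p(1)]
  obtain m where m: "x = p * m" using p'(3) by blast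
  have "\<not> p dvd m"
  proof
    assume "p dvd m"
    then have "p\<^sup>2 dvd x" unfolding m power2_eq_square by (intro mult_dvd_mono) auto
    then show False using squarefreeD[OF squarefree_x] p'(2) by fastforce
  qed
  then have cop: "coprime (int p) (int m)"
    using p'(1) prime_imp_coprime by (auto simp: coprime_int_iff)
  obtain r where r: "Legendre r (int p) = -1" using exists_nonresidue[OF p'(1,2)] by blast
  obtain c where c: "[c = r] (mod int p)" "[c = 1] (mod int m)"
    using binary_chinese_remainder_int[OF cop] by blast
  have "Legendre c (int q) = 1" if "q \<in> prime_factors x - {p}" for q
  proof -
    have "prime q" "q dvd p * m" "q \<noteq> p" using that prime_factor_gt_2[of q] m by auto
    then have "q dvd m" using p'(1) by (meson primes_dvd_imp_eq prime_dvd_mult_iff)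
    then have "[c = 1] (mod int q)" using c(2) cong_dvd_modulus int_dvd_int_iff by blast
    then show ?thesis using Legendre_cong Legendre_1[OF \<open>prime q\<close>] by simp
  qed
  moreover have "jacobi c = Legendre c (int p) * (\<Prod>q\<in>prime_factors x - {p}. Legendre c (int q))"
    unfolding jacobi_def using p(1) by (intro prod.remove) auto
  moreover have "Legendre c (int p) = -1" using Legendre_cong[OF c(1)] r by simp
  ultimately have jacobi: "jacobi c = -1" by simp
  then have "coprime c (int x)" using jacobi_eq_0_iff[of c] by auto
  moreover have "[c * k = k] (mod int x)"
  proof -
    have "int m * int p dvd (c - 1) * k"
      using c(2) p(2) by (intro mult_dvd_mono) (auto simp: cong_iff_dvd_diff)
    then show ?thesis using m by (simp add: cong_iff_dvd_diff algebra_simps)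
  qed
  then have "gauss_sum (c * k) = gauss_sum k"
    unfolding gauss_sum_def
    by (intro sum.cong refl arg_cong2[of _ _ _ _ "(*)"] zeta_pow_cong)
      (metis cong_scalar_left)
  ultimately have "gauss_sum k = - gauss_sum k" using gauss_sum_scale[of c k] jacobi by simp
  then show ?thesis by simp
qed

lemma gauss_sum_eq: "gauss_sum k = of_int (jacobi k) * gauss_sum 1"
proof (cases "coprime k (int x)")
  case True
  then have "of_int (jacobi k) * gauss_sum 1 = of_int ((jacobi k)\<^sup>2) * gauss_sum k"
    using gauss_sum_scale[OF True, of 1] by (simp add: power2_eq_square)
  then show ?thesis using jacobi_square[of k] True by simp
next
  case False
  then show ?thesis using gauss_sum_not_coprime jacobi_eq_0_iff[of k] by simp
qed

text \<open>Parseval's identity: \<open>\<Sum>\<^sub>k \<gamma>(k) \<gamma>(-k) = x \<Sum>\<^sub>k \<chi>(k)\<^sup>2\<close>. On the left each term is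
  \<open>\<chi>(k) \<chi>(-k) \<gamma>(1)\<^sup>2 = - \<chi>(k)\<^sup>2 \<gamma>(1)\<^sup>2\<close>, and the common sum can be cancelled. In this way only the
  square of the Gauss sum is determined, and no choice of a square root is made.\<close>

lemma gauss_sum_square: "(gauss_sum 1)\<^sup>2 = - of_nat x"
proof -
  define S where "S = (\<Sum>k<x. (jacobi (int k))\<^sup>2)"
  have "jacobi (int 1) = 1" by (simp add: jacobi_1)
  then have "(jacobi (int 1))\<^sup>2 \<le> S"
    unfolding S_def using x_ge_3 by (intro member_le_sum) auto
  then have S: "S \<noteq> 0" by (simp add: jacobi_1)
  have neg: "jacobi (- k) = - jacobi k" for k
    using jacobi_mult[of "-1" k] by (simp add: jacobi_minus_1)
  have "(\<Sum>k<x. gauss_sum (int k) * gauss_sum (- int k)) = - (gauss_sum 1)\<^sup>2 * of_int S"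
    unfolding S_def of_int_sum sum_distrib_left
    by (intro sum.cong refl, subst (1 2) gauss_sum_eq) (simp add: neg power2_eq_square)
  also have "(\<Sum>k<x. gauss_sum (int k) * gauss_sum (- int k)) =
     (\<Sum>k<x. \<Sum>i<x. \<Sum>j<x. of_int (jacobi (int i) * jacobi (int j)) * zeta_pow (int k * (int i - int j)))"
  proof (intro sum.cong refl)
    fix k
    show "gauss_sum (int k) * gauss_sum (- int k) =
      (\<Sum>i<x. \<Sum>j<x. of_int (jacobi (int i) * jacobi (int j)) * zeta_pow (int k * (int i - int j)))"
      unfolding gauss_sum_def sum_product
    proof (intro sum.cong refl)
      fix i j :: nat
      have "int k * (int i - int j) = int i * int k + int j * - int k" by (simp add: algebra_simps)
      then show "of_int (jacobi (int i)) * zeta_pow (int i * int k) *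
          (of_int (jacobi (int j)) * zeta_pow (int j * - int k)) =
          of_int (jacobi (int i) * jacobi (int j)) * zeta_pow (int k * (int i - int j))"
        by (simp only: zeta_pow_add) (simp add: mult_ac)
    qed
  qed
  also have "\<dots> = (\<Sum>i<x. \<Sum>j<x. \<Sum>k<x.
      of_int (jacobi (int i) * jacobi (int j)) * zeta_pow (int k * (int i - int j)))"
    by (subst sum.swap, rule sum.cong[OF refl], rule sum.swap)
  also have "\<dots> = (\<Sum>i<x. \<Sum>j<x. if i = j then of_nat x * of_int ((jacobi (int i))\<^sup>2) else 0)"
  proof (intro sum.cong refl)
    fix i j assume ij: "i \<in> {..<x}" "j \<in> {..<x}"
    have "int x dvd int i - int j \<longleftrightarrow> i = j"
      using ij by (auto simp: cong_iff_dvd_diff[symmetric] cong_int_iff cong_def)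
    then show "(\<Sum>k<x. of_int (jacobi (int i) * jacobi (int j)) * zeta_pow (int k * (int i - int j))) =
        (if i = j then of_nat x * of_int ((jacobi (int i))\<^sup>2) else (0::complex))"
      by (simp add: sum_distrib_left[symmetric] sum_zeta_pow power2_eq_square)
  qed
  also have "\<dots> = of_nat x * of_int S"
    by (simp add: S_def sum_distrib_left)
  finally have "of_int S * ((gauss_sum 1)\<^sup>2 + of_nat x) = 0" by (simp add: algebra_simps)
  then show ?thesis using S by (simp add: eq_neg_iff_add_eq_0)
qed

text \<open>The eigenvalues \<open>\<lambda>\<^sub>k\<close> of the circulant matrix with entries \<open>\<chi>(j - i - 1)\<close>. The twist by
  \<open>\<zeta>\<^sup>k\<close> moves the value \<open>\<chi>(-1)\<close> to the diagonal of that matrix, so that the trace is odd.\<close>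

definition lam :: "nat \<Rightarrow> complex" where
  "lam k = zeta_pow (int k) * gauss_sum (int k)"

lemma lam_square:
  "(lam k)\<^sup>2 = (if coprime k x then - of_nat x * zeta_pow (2 * int k) else 0)"
proof -
  have "(lam k)\<^sup>2 = (zeta_pow (int k))\<^sup>2 * of_int ((jacobi (int k))\<^sup>2) * (gauss_sum 1)\<^sup>2"
    by (simp add: lam_def gauss_sum_eq[of "int k"] power_mult_distrib)
  also have "(zeta_pow (int k))\<^sup>2 = zeta_pow (2 * int k)" by (simp add: zeta_pow_power)
  finally show ?thesis by (simp add: jacobi_square gauss_sum_square)
qed

lemma lam_not_coprime: "\<not> coprime k x \<Longrightarrow> lam k = 0"
  by (simp add: lam_def gauss_sum_not_coprime)

text \<open>This is the trace of the circulant matrix with entries \<open>\<chi>(j - i - 1)\<close>, whose diagonal is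
  constantly \<open>\<chi>(-1)\<close>.\<close>

lemma sum_lam: "(\<Sum>k<x. lam k) = - of_nat x"
proof -
  have "(\<Sum>k<x. lam k) = (\<Sum>k<x. \<Sum>j<x. of_int (jacobi (int j)) * zeta_pow (int k * (int j + 1)))"
    unfolding lam_def gauss_sum_def sum_distrib_left
    by (intro sum.cong refl) (simp add: ring_distribs zeta_pow_add mult_ac)
  also have "\<dots> = (\<Sum>j<x. of_int (jacobi (int j)) * (\<Sum>k<x. zeta_pow (int k * (int j + 1))))"
    by (subst sum.swap) (simp add: sum_distrib_left)
  also have "\<dots> = (\<Sum>j<x. if j = x - 1 then - of_nat x else 0)"
  proof (intro sum.cong refl)
    fix j assume j: "j \<in> {..<x}"
    show "of_int (jacobi (int j)) * (\<Sum>k<x. zeta_pow (int k * (int j + 1))) =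
        (if j = x - 1 then - of_nat x else (0::complex))"
    proof (cases "j = x - 1")
      case True
      then have "int j + 1 = int x" using x_pos by simp
      moreover from this have "[int j = -1] (mod int x)" by (simp add: cong_iff_dvd_diff)
      then have "jacobi (int j) = -1" using jacobi_cong jacobi_minus_1 by metis
      ultimately show ?thesis using True by (simp add: sum_zeta_pow)
    next
      case False
      then have "\<not> int x dvd int j + 1" using j by (auto dest!: zdvd_imp_le)
      then show ?thesis using False by (simp add: sum_zeta_pow)
    qed
  qed
  also have "\<dots> = - of_nat x" using x_pos by simp
  finally show ?thesis .
qed

text \<open>For odd \<open>p\<close> coprime to \<open>x\<close>, raising to the \<open>p\<close>-th power permutes the eigenvalues by
  \<open>k \<mapsto> pk\<close>, apart from an integer factor that does not depend on \<open>k\<close>.\<close>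

lemma lam_power:
  assumes "coprime p x" "odd p"
  shows "lam k ^ p =
    of_int (jacobi (int p) * (- int x) ^ ((p - 1) div 2)) * (zeta_pow (int p * int k) * gauss_sum (int p * int k))"
proof (cases "coprime k x")
  case True
  obtain m where p: "p = 2 * m + 1" using assms(2) oddE by blast
  have "(gauss_sum (int k))\<^sup>2 = of_int ((jacobi (int k))\<^sup>2) * (gauss_sum 1)\<^sup>2"
    by (simp add: gauss_sum_eq[of "int k"] power_mult_distrib)
  also have "\<dots> = - of_nat x" using True by (simp only: jacobi_square gauss_sum_square) simp
  finally have "gauss_sum (int k) ^ p = gauss_sum (int k) * (- of_nat x) ^ m"
    by (simp add: p power_mult)
  moreover have "gauss_sum (int k) = of_int (jacobi (int p)) * gauss_sum (int p * int k)"
    using assms(1) by (intro gauss_sum_scale) simp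
  moreover have "(p - 1) div 2 = m" using p by simp
  ultimately show ?thesis
    by (simp add: lam_def power_mult_distrib zeta_pow_power)
next
  case False
  then show ?thesis using assms(2)
    by (simp add: lam_not_coprime gauss_sum_not_coprime odd_pos)
qed

text \<open>For \<open>c\<close> coprime to \<open>x\<close> the numbers \<open>\<zeta>\<^bsup>ck\<^esup>\<close> run through all roots of \<open>t\<^sup>x - 1\<close>, and the product is
  this polynomial with reversed coefficients.\<close>

lemma prod_zeta_pow:
  assumes "coprime c (int x)"
  shows "(\<Prod>k<x. 1 - zeta_pow (c * int k) * w) = 1 - w ^ x"
proof -
  have "inj_on (\<lambda>k. zeta_pow (int k)) {..<x}"
  proof (rule inj_onI)
    fix i j assume ij: "i \<in> {..<x}" "j \<in> {..<x}" "zeta_pow (int i) = zeta_pow (int j)"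
    have "zeta_pow (int i - int j) * zeta_pow (int j) = 1 * zeta_pow (int j)"
      using ij(3) zeta_pow_add[of "int i - int j" "int j"] by simp
    moreover have "zeta_pow (int j) \<noteq> 0" by (simp add: zeta_pow_def)
    ultimately have "int x dvd int i - int j" by (simp add: zeta_pow_eq_1_iff)
    then show "i = j"
      using ij(1,2) by (auto simp: cong_iff_dvd_diff[symmetric] cong_int_iff cong_def)
  qed
  then have card: "card ((\<lambda>k. zeta_pow (int k)) ` {..<x}) = x" by (simp add: card_image)
  have deg: "degree (\<Prod>k<x. [:- zeta_pow (int k), 1:]) = x"
    by (simp add: degree_prod_sum_eq)
  moreover have "lead_coeff (\<Prod>k<x. [:- zeta_pow (int k), 1:]) = 1"
    by (simp add: lead_coeff_prod)
  ultimately have "(\<Prod>k<x. [:- zeta_pow (int k), 1:]) = Polynomial.monom 1 x - 1"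
    using card x_pos
    by (intro poly_eqI_degree_lead_coeff[of _ x _ "(\<lambda>k. zeta_pow (int k)) ` {..<x}"])
      (auto simp: poly_prod poly_monom zeta_pow_power zeta_pow_x_mult degree_monom_eq intro: degree_diff_le)
  then have eq: "(\<Prod>k<x. t - zeta_pow (int k)) = t ^ x - 1" for t
    by (drule_tac arg_cong[where f = "\<lambda>q. poly q t"]) (simp add: poly_prod poly_monom)
  have "(\<Prod>k<x. 1 - zeta_pow (c * int k) * w) = (\<Prod>k<x. 1 - zeta_pow (int k) * w)"
    using prod_affine_reindex[of x c "\<lambda>j. 1 - zeta_pow j * w" 0, OF x_pos assms] by simp
  also have "\<dots> = 1 - w ^ x"
  proof (cases "w = 0")
    case False
    have "(\<Prod>k<x. 1 - zeta_pow (int k) * w) = (\<Prod>k<x. w * (inverse w - zeta_pow (int k)))"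
      using False by (intro prod.cong refl) (simp add: right_diff_distrib mult.commute)
    also have "\<dots> = w ^ x * (inverse w ^ x - 1)" by (simp add: prod.distrib eq)
    also have "\<dots> = 1 - w ^ x"
      using False by (simp add: right_diff_distrib flip: power_mult_distrib)
    finally show ?thesis .
  qed (use x_pos in simp)
  finally show ?thesis .
qed

section \<open>An integral polynomial with prescribed reciprocal roots\<close>

text \<open>Row \<open>i\<close> of the circulant matrix, applied to a Fourier vector, gives this sum with
  \<open>d = - i - 1\<close>; so it exhibits the eigenvalues.\<close>

lemma gauss_sum_shift:
  "(\<Sum>j<x. of_int (jacobi (int j + d)) * zeta_pow (int j * k)) = zeta_pow (- d * k) * gauss_sum k"
proof -
  let ?f = "\<lambda>j. of_int (jacobi (j + d)) * zeta_pow (j * k)"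
  have "?f (j mod int x) = ?f j" for j
  proof -
    have "jacobi (j mod int x + d) = jacobi (j + d)" by (rule jacobi_cong) (simp add: cong_def mod_add_left_eq)
    moreover have "zeta_pow (j mod int x * k) = zeta_pow (j * k)"
      by (rule zeta_pow_cong) (simp add: cong_def mod_mult_left_eq)
    ultimately show ?thesis by simp
  qed
  then have "(\<Sum>j<x. ?f (int j)) = (\<Sum>j<x. ?f (1 * int j + - d))"
    using sum_affine_reindex[of x 1 ?f "- d", OF x_pos] by simp
  also have "\<dots> = zeta_pow (- d * k) * gauss_sum k"
    unfolding gauss_sum_def sum_distrib_left
  proof (rule sum.cong[OF refl])
    fix j
    have "(1 * int j + - d) * k = - d * k + int j * k" by (simp add: algebra_simps)
    then show "of_int (jacobi (1 * int j + - d + d)) * zeta_pow ((1 * int j + - d) * k) =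
       zeta_pow (- d * k) * (of_int (jacobi (int j)) * zeta_pow (int j * k))"
      by (simp only: zeta_pow_add) (simp add: mult_ac)
  qed
  finally show ?thesis .
qed

text \<open>The matrix \<open>H\<close> with entries \<open>\<chi>(j - i - 1)\<close> is integral, and the discrete Fourier transform
  \<open>F\<close> diagonalizes it with the eigenvalues \<open>\<lambda>\<^sub>k\<close>. The required polynomial is the characteristic
  polynomial of \<open>H\<close> with its coefficients reversed.\<close>

lemma ex_int_poly_lam:
  "\<exists>L :: int poly. of_int_poly L = (\<Prod>k<x. [:1, - lam k:])"
proof -
  \<comment> \<open>\<open>G\<close> is the inverse Fourier transform and \<open>D\<close> the diagonal of eigenvalues.\<close>
  define H where "H = mat x x (\<lambda>(i, j). jacobi (int j + - (int i + 1)))"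
  define Hc where "Hc = map_mat complex_of_int H"
  define F where "F = mat x x (\<lambda>(i, k). zeta_pow (int i * int k))"
  define G where "G = mat x x (\<lambda>(k, j). zeta_pow (- (int k * int j)) / of_nat x)"
  define D where "D = mat x x (\<lambda>(i, j). if i = j then lam i else 0)"
  have carr: "H \<in> carrier_mat x x" "Hc \<in> carrier_mat x x" "F \<in> carrier_mat x x"
    "G \<in> carrier_mat x x" "D \<in> carrier_mat x x"
    by (simp_all add: H_def Hc_def F_def G_def D_def)
  have FG: "F * G = 1\<^sub>m x"
  proof (rule eq_matI)
    fix i j assume ij: "i < dim_row (1\<^sub>m x)" "j < dim_col (1\<^sub>m x)"
    have "(F * G) $$ (i, j) = (\<Sum>k<x. zeta_pow (int i * int k) * (zeta_pow (- (int k * int j)) / of_nat x))"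
      using ij by (simp add: F_def G_def scalar_prod_def atLeast0LessThan)
    also have "\<dots> = (\<Sum>k<x. zeta_pow (int k * (int i - int j))) / of_nat x"
      unfolding sum_divide_distrib
      by (rule sum.cong[OF refl]) (simp add: zeta_pow_add[symmetric] algebra_simps)
    also have "\<dots> = 1\<^sub>m x $$ (i, j)"
    proof -
      have "int x dvd int i - int j \<longleftrightarrow> i = j"
        using ij by (auto simp: cong_iff_dvd_diff[symmetric] cong_int_iff cong_def)
      then show ?thesis using ij x_pos by (simp add: sum_zeta_pow)
    qed
    finally show "(F * G) $$ (i, j) = 1\<^sub>m x $$ (i, j)" .
  qed (simp_all add: F_def G_def)
  have GF: "G * F = 1\<^sub>m x" using mat_mult_left_right_inverse[OF carr(3,4) FG] .
  have HF: "Hc * F = F * D"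
  proof (rule eq_matI)
    fix i k assume "i < dim_row (F * D)" "k < dim_col (F * D)"
    then have ik: "i < x" "k < x" using carr by auto
    have "(Hc * F) $$ (i, k) =
        (\<Sum>j<x. of_int (jacobi (int j + - (int i + 1))) * zeta_pow (int j * int k))"
      using ik by (simp add: Hc_def H_def F_def scalar_prod_def atLeast0LessThan)
    also have "\<dots> = zeta_pow (- (- (int i + 1)) * int k) * gauss_sum (int k)" by (rule gauss_sum_shift)
    also have "\<dots> = zeta_pow (int i * int k) * lam k"
      by (simp add: lam_def ring_distribs zeta_pow_add)
    also have "\<dots> = (\<Sum>j<x. zeta_pow (int i * int j) * (if j = k then lam j else 0))"
      using ik by (simp add: if_distrib cong: if_cong)
    also have "\<dots> = (F * D) $$ (i, k)"
      using ik by (simp add: F_def D_def scalar_prod_def atLeast0LessThan)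
    finally show "(Hc * F) $$ (i, k) = (F * D) $$ (i, k)" .
  qed (use carr in auto)
  have "Hc = Hc * (F * G)" using carr FG by simp
  also have "\<dots> = F * D * G" using carr HF by (simp flip: assoc_mult_mat)
  finally have "similar_mat Hc D"
    unfolding similar_mat_def using similar_mat_witI[OF FG GF _ carr(2,5,3,4)] by blast
  then have "char_poly Hc = char_poly D" by (rule char_poly_similar)
  also have "\<dots> = (\<Prod>a\<leftarrow>diag_mat D. [:- a, 1:])"
    by (rule char_poly_upper_triangular[OF carr(5)]) (auto simp: upper_triangular_def D_def)
  also have "diag_mat D = map lam [0..<x]"
    by (rule nth_equalityI) (auto simp: diag_mat_def D_def)
  also have "(\<Prod>a\<leftarrow>map lam [0..<x]. [:- a, 1:]) = (\<Prod>k<x. [:- lam k, 1:])"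
    by (simp add: prod.distinct_set_conv_list[symmetric] atLeast0LessThan flip: prod.distinct_set_conv_list)
  finally have "of_int_poly (char_poly H) = (\<Prod>k<x. [:- lam k, 1:])"
    unfolding Hc_def of_int_hom.char_poly_hom[OF carr(1)] .
  then have "reflect_poly (of_int_poly (char_poly H)) = (\<Prod>k<x. reflect_poly [:- lam k, 1:])"
    by (simp add: reflect_poly_prod)
  moreover have "reflect_poly [:- c, 1:] = [:1, - c:]" for c :: complex
    by (cases "c = 0") (simp_all add: reflect_poly_pCons' monom_Suc monom_0)
  moreover have "reflect_poly (of_int_poly (char_poly H)) = (of_int_poly (reflect_poly (char_poly H)) :: complex poly)"
    by (rule poly_eqI) (simp add: coeff_reflect_poly coeff_map_poly)
  ultimately show ?thesis by (metis (no_types, lifting) prod.cong)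
qed

end

section \<open>Aurifeuillian factors\<close>

text \<open>A polynomial with constant term 1 is a unit in the ring of integer power series, so division by
  it does not leave the integers. All factors below have constant term 1, and this replaces any
  appeal to Galois theory for their integrality.\<close>

lemma int_poly_quotient:
  fixes P R :: "int poly" and q :: "complex poly"
  assumes eq: "of_int_poly P * q = of_int_poly R" and P0: "coeff P 0 = 1"
  shows "\<exists>Q :: int poly. q = of_int_poly Q"
proof -
  have ints: "coeff q n \<in> \<int>" for n
  proof (induct n rule: less_induct)
    case (less n)
    have "of_int (coeff R n) = (\<Sum>i\<le>n. of_int (coeff P i) * coeff q (n - i))"
      using arg_cong[OF eq, of "\<lambda>p. coeff p n"] by (simp add: coeff_mult coeff_map_poly)
    also have "\<dots> = coeff q n + (\<Sum>i\<in>{..n} - {0}. of_int (coeff P i) * coeff q (n - i))"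
      by (subst sum.remove[of _ 0]) (simp_all add: P0)
    finally have "coeff q n =
        of_int (coeff R n) - (\<Sum>i\<in>{..n} - {0}. of_int (coeff P i) * coeff q (n - i))"
      by (simp add: algebra_simps)
    also have "\<dots> \<in> \<int>"
      by (intro Ints_diff Ints_of_int Ints_sum Ints_mult less) auto
    finally show ?case .
  qed
  then have "q = of_int_poly (map_poly (\<lambda>z. \<lfloor>Re z\<rfloor>) q)"
  proof (intro poly_eqI)
    fix n
    obtain m where "coeff q n = of_int m" using ints[of n] Ints_cases by blast
    then show "coeff q n = coeff (of_int_poly (map_poly (\<lambda>z. \<lfloor>Re z\<rfloor>) q)) n"
      by (simp add: coeff_map_poly)
  qed
  then show ?thesis by blast
qed

lemma coeff_mult_1: "coeff (p * q) 1 = coeff p 0 * coeff q 1 + coeff p 1 * coeff q 0"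
  by (simp add: coeff_mult)

lemma coeff_prod_linear:
  fixes a :: "nat \<Rightarrow> 'a :: comm_ring_1"
  shows "coeff (\<Prod>k<n. [:1, - a k:]) 0 = 1" and "coeff (\<Prod>k<n. [:1, - a k:]) 1 = - (\<Sum>k<n. a k)"
proof -
  have "coeff (\<Prod>k<n. [:1, - a k:]) 0 = 1 \<and> coeff (\<Prod>k<n. [:1, - a k:]) 1 = - (\<Sum>k<n. a k)"
    by (induct n) (simp_all add: coeff_mult_1[simplified])
  then show "coeff (\<Prod>k<n. [:1, - a k:]) 0 = 1"
      "coeff (\<Prod>k<n. [:1, - a k:]) 1 = - (\<Sum>k<n. a k)" by auto
qed

lemma coeff_1_eq_pderiv: "coeff p 1 = poly (pderiv p) 0"
  by (simp add: poly_0_coeff_0 coeff_pderiv)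

context aurifeuillian_modulus
begin

definition lamX :: "nat \<Rightarrow> complex poly" where
  "lamX k = [:0, lam k:]"

definition Y :: "int poly" where
  "Y = Polynomial.monom (- int x) 2"

lemma lamX_square: "coprime k x \<Longrightarrow> lamX k ^ 2 = smult (zeta_pow (2 * int k)) (of_int_poly Y)"
  and lamX_not_coprime: "\<not> coprime k x \<Longrightarrow> lamX k = 0"
proof -
  assume "coprime k x"
  then have "lamX k ^ 2 = [:0, 0, - of_nat x * zeta_pow (2 * int k):]"
    using lam_square[of k] by (simp add: lamX_def power2_eq_square)
  also have "\<dots> = smult (zeta_pow (2 * int k)) (of_int_poly Y)"
    by (simp add: Y_def monom_Suc monom_0 numeral_2_eq_2 of_int_hom.map_poly_pCons_hom mult.commute)
  finally show "lamX k ^ 2 = smult (zeta_pow (2 * int k)) (of_int_poly Y)" .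
next
  assume "\<not> coprime k x"
  then show "lamX k = 0" by (simp add: lamX_def lam_not_coprime)
qed

lemma prod_zeta_pow_poly:
  assumes "coprime c (int x)"
  shows "(\<Prod>k<x. 1 - smult (zeta_pow (c * int k)) W) = 1 - W ^ x"
  by (rule poly_eq_poly_eq_iff[THEN iffD1], rule ext)
    (simp add: poly_prod prod_zeta_pow[OF assms])

text \<open>If \<open>\<beta>(X\<^sup>2)\<close> splits as \<open>\<theta>(X) \<theta>(-X)\<close>, then the norm of \<open>\<beta>\<close> splits off the norms of \<open>\<theta>\<close> at
  \<open>s \<lambda>\<^sub>k\<close> and at \<open>-s \<lambda>\<^sub>k\<close>. For \<open>k\<close> not coprime to \<open>x\<close> both \<open>\<theta>\<close>-factors are \<open>\<theta>(0) = 1\<close>, so these \<open>k\<close>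
  contribute only to the cofactor \<open>E\<close>. The result is used for \<open>\<theta>(X) = 1 - X\<close> and for
  \<open>\<theta>(X) = 1 + X + \<dots> + X\<^bsup>p-1\<^esup>\<close>.\<close>

lemma aurifeuillian_factorization:
  fixes \<theta> \<beta> :: "complex poly \<Rightarrow> complex poly" and D B :: "int poly"
  assumes split: "\<And>X. \<theta> X * \<theta> (- X) = \<beta> (X ^ 2)"
    and subst: "\<And>X p. pcompose (\<theta> X) p = \<theta> (pcompose X p)"
    and zero: "\<theta> 0 = 1"
    and D: "of_int_poly D = (\<Prod>k<x. \<theta> (lamX k))"
    and D0: "coeff D 0 = 1"
    and B: "of_int_poly B = (\<Prod>k<x. \<beta> (smult (zeta_pow (2 * int k)) (of_int_poly Y)))"
  shows "\<exists>E. D * pcompose D [:0, -1:] * E = B"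
proof -
  let ?y = "\<lambda>k. smult (zeta_pow (2 * int k)) (of_int_poly Y)"
  let ?D' = "pcompose D [:0, -1:]"
  have neg: "pcompose (lamX k) [:0, -1:] = - lamX k" for k
    by (simp add: lamX_def pcompose_pCons)
  have D': "of_int_poly ?D' = (\<Prod>k<x. \<theta> (- lamX k))"
    by (simp add: of_int_hom.map_poly_pcompose D pcompose_prod subst neg)
  have "\<beta> (?y k) = \<theta> (lamX k) * \<theta> (- lamX k) * (if coprime k x then 1 else \<beta> (?y k))" for k
    by (cases "coprime k x") (simp_all add: split lamX_square lamX_not_coprime zero)
  then have "of_int_poly B =
      (\<Prod>k<x. \<theta> (lamX k) * \<theta> (- lamX k) * (if coprime k x then 1 else \<beta> (?y k)))"
    unfolding B by (intro prod.cong refl)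
  also have "\<dots> = of_int_poly (D * ?D') * (\<Prod>k<x. if coprime k x then 1 else \<beta> (?y k))"
    by (simp only: prod.distrib D[symmetric] D'[symmetric] of_int_poly_hom.hom_mult)
  finally have eq: "of_int_poly (D * ?D') * (\<Prod>k<x. if coprime k x then 1 else \<beta> (?y k)) =
      of_int_poly B" by simp
  have "coeff ?D' 0 = 1" using D0 by (simp add: poly_pcompose flip: poly_0_coeff_0)
  then have "coeff (D * ?D') 0 = 1" using D0 by (simp add: coeff_mult)
  from int_poly_quotient[OF eq this]
  obtain E where "(\<Prod>k<x. if coprime k x then 1 else \<beta> (?y k)) = (of_int_poly E :: complex poly)"
    by blast
  with eq have "(of_int_poly (D * ?D' * E) :: complex poly) = of_int_poly B"
    by (simp add: hom_distribs)
  then show ?thesis by (metis of_int_poly_hom.injectivity)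
qed

lemma coprime_2_x: "coprime 2 (int x)"
  using odd_x by simp

text \<open>The linear coefficient is the negated trace of the circulant matrix.\<close>

lemma ex_linear_norm:
  "\<exists>L :: int poly. of_int_poly L = (\<Prod>k<x. 1 - lamX k) \<and> coeff L 0 = 1 \<and> coeff L 1 = int x"
proof -
  obtain L :: "int poly" where L: "of_int_poly L = (\<Prod>k<x. [:1, - lam k:])"
    using ex_int_poly_lam by blast
  have c: "of_int (coeff L i) = coeff (\<Prod>k<x. [:1, - lam k:]) i" for i
    unfolding L[symmetric] by (simp add: coeff_map_poly)
  have "(of_int (coeff L 0) :: complex) = of_int 1" "(of_int (coeff L 1) :: complex) = of_int (int x)"
    unfolding c coeff_prod_linear by (simp_all add: sum_lam)
  moreover have "1 - lamX k = [:1, - lam k:]" for k by (simp add: lamX_def one_pCons)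
  ultimately show ?thesis using L by (intro exI[of _ L]) (simp only: of_int_eq_iff)
qed

lemma factor_one_minus_Y_power_x:
  "\<exists>D K :: int poly. D * K = 1 - Y ^ x \<and> coeff D 0 = 1 \<and> odd (coeff D 1)"
proof -
  obtain L :: "int poly" where L: "of_int_poly L = (\<Prod>k<x. 1 - lamX k)" "coeff L 0 = 1"
      "coeff L 1 = int x"
    using ex_linear_norm by blast
  have "\<exists>E. L * pcompose L [:0, -1:] * E = 1 - Y ^ x"
  proof (rule aurifeuillian_factorization[where \<theta> = "\<lambda>X. 1 - X" and \<beta> = "\<lambda>X. 1 - X", OF _ _ _ L(1,2)])
    show "of_int_poly (1 - Y ^ x) = (\<Prod>k<x. 1 - smult (zeta_pow (2 * int k)) (of_int_poly Y))"
      using prod_zeta_pow_poly[OF coprime_2_x] by (simp add: hom_distribs)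
  qed (simp_all add: algebra_simps power2_eq_square pcompose_diff pcompose_1)
  then show ?thesis using L odd_x by (metis mult.assoc even_of_nat)
qed

text \<open>The norm of \<open>1 - (s \<lambda>\<^sub>k)\<^sup>p\<close> is integral because the \<open>p\<close>-th powers of the eigenvalues are
  the eigenvalues again up to an integer factor, and the polynomial in question is its quotient by
  the norm of \<open>1 - s \<lambda>\<^sub>k\<close>. Since the former has no linear term, the linear coefficient of the
  quotient is \<open>-x\<close>.\<close>

lemma geometric_norm:
  assumes p: "odd p" "p > 1" "coprime p x"
  shows "\<exists>D :: int poly. of_int_poly D = (\<Prod>k<x. \<Sum>i<p. lamX k ^ i) \<and> coeff D 0 = 1 \<and> odd (coeff D 1)"
proof -
  obtain L :: "int poly" where L: "of_int_poly L = (\<Prod>k<x. 1 - lamX k)" "coeff L 0 = 1"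
      "coeff L 1 = int x"
    using ex_linear_norm by blast
  define c where "c = jacobi (int p) * (- int x) ^ ((p - 1) div 2)"
  define s where "s = Polynomial.monom c p"
  have powr: "[:0, a:] ^ p = Polynomial.monom (a ^ p) p" for a :: complex
    by (metis monom_power monom_Suc monom_0 mult_1 One_nat_def)
  have "of_int_poly (pcompose L s) = (\<Prod>k<x. 1 - smult (lam k) (of_int_poly s))"
    by (simp add: of_int_hom.map_poly_pcompose L(1) pcompose_prod pcompose_diff pcompose_1
        lamX_def pcompose_pCons)
  also have "\<dots> = (\<Prod>k<x. 1 - smult (zeta_pow (int p * int k) * gauss_sum (int p * int k)) (of_int_poly s))"
  proof -
    have "gauss_sum (j mod int x) = gauss_sum j" for j
      using gauss_sum_eq[of j] gauss_sum_eq[of "j mod int x"] by simp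
    then show ?thesis
      unfolding lam_def
      using prod_affine_reindex[of x "int p" "\<lambda>j. 1 - smult (zeta_pow j * gauss_sum j) (of_int_poly s)" 0, OF x_pos]
        p(3) by simp
  qed
  also have "\<dots> = (\<Prod>k<x. 1 - lamX k ^ p)"
    unfolding lamX_def powr lam_power[OF p(3,1)] s_def c_def[symmetric]
    by (simp add: map_poly_monom smult_monom mult.commute)
  also have "\<dots> = of_int_poly L * (\<Prod>k<x. \<Sum>i<p. lamX k ^ i)"
    by (simp add: L(1) one_diff_power_eq prod.distrib)
  finally have eq: "of_int_poly L * (\<Prod>k<x. \<Sum>i<p. lamX k ^ i) = of_int_poly (pcompose L s)" by simp
  from int_poly_quotient[OF eq L(2)]
  obtain D :: "int poly" where D: "(\<Prod>k<x. \<Sum>i<p. lamX k ^ i) = of_int_poly D" by blast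
  with eq have "(of_int_poly (L * D) :: complex poly) = of_int_poly (pcompose L s)"
    by (simp add: hom_distribs)
  then have LD: "L * D = pcompose L s" by (metis of_int_poly_hom.injectivity)
  have "poly s 0 = 0" "poly (pderiv s) 0 = 0" using p(2) by (simp_all add: s_def poly_monom pderiv_monom)
  then have "coeff (pcompose L s) 0 = 1" "coeff (pcompose L s) 1 = 0"
    using L(2) unfolding coeff_1_eq_pderiv
    by (simp_all add: pderiv_pcompose poly_pcompose poly_0_coeff_0[symmetric])
  then have "coeff D 0 = 1" "int x * coeff D 0 + coeff D 1 = 0"
    using L(2,3) coeff_mult_1[of L D] by (simp_all add: LD[symmetric] coeff_mult_0)
  then show ?thesis using D odd_x by (intro exI[of _ D]) (auto simp: add_eq_0_iff)
qed

text \<open>The factor \<open>D'\<close> arises from \<open>D\<close> by changing the sign of the variable, which preserves the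
  constant term and the parity of the linear one.\<close>

lemma factor_geometric_sum:
  assumes p: "odd p" "p > 1" "coprime p x"
  shows "\<exists>D D' E :: int poly. D * D' * E = (\<Sum>i<p. (Y ^ x) ^ i) \<and>
    coeff D 0 = 1 \<and> odd (coeff D 1) \<and> coeff D' 0 = 1 \<and> odd (coeff D' 1)"
proof -
  obtain D :: "int poly" where D: "of_int_poly D = (\<Prod>k<x. \<Sum>i<p. lamX k ^ i)"
      "coeff D 0 = 1" "odd (coeff D 1)"
    using geometric_norm[OF assms] by blast
  let ?D' = "pcompose D [:0, -1:]"
  let ?y = "\<lambda>k. smult (zeta_pow (2 * int k)) (of_int_poly Y)"
  let ?Y = "of_int_poly Y :: complex poly"
  \<comment> \<open>For odd \<open>p\<close> the identity follows by multiplying with \<open>1 - X\<^sup>2\<close>, unless this is zero.\<close>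
  have split: "(\<Sum>i<p. X ^ i) * (\<Sum>i<p. (- X) ^ i) = (\<Sum>i<p. (X ^ 2) ^ i)" for X :: "complex poly"
  proof (cases "X = 1 \<or> X = -1")
    case True
    have "(\<Sum>i<p. (- 1 :: complex poly) ^ i) = 1" using p(1)
      by (induct p rule: nat_induct2) simp_all
    then show ?thesis using True by auto
  next
    case False
    have "(1 - X) * (1 + X) * ((\<Sum>i<p. X ^ i) * (\<Sum>i<p. (- X) ^ i)) =
        ((1 - X) * (\<Sum>i<p. X ^ i)) * ((1 - (- X)) * (\<Sum>i<p. (- X) ^ i))" by (simp add: mult_ac)
    also have "\<dots> = (1 - X ^ p) * (1 - (- X) ^ p)" by (simp only: one_diff_power_eq)
    also have "\<dots> = (1 - X ^ p) * (1 + X ^ p)" using p(1) by simp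
    also have "\<dots> = 1 - (X ^ 2) ^ p" by (simp add: algebra_simps power2_eq_square power_mult_distrib)
    also have "\<dots> = (1 - X ^ 2) * (\<Sum>i<p. (X ^ 2) ^ i)" by (rule one_diff_power_eq)
    also have "1 - X ^ 2 = (1 - X) * (1 + X)" by (simp add: algebra_simps power2_eq_square)
    finally have "(1 - X) * (1 + X) * ((\<Sum>i<p. X ^ i) * (\<Sum>i<p. (- X) ^ i)) =
      (1 - X) * (1 + X) * (\<Sum>i<p. (X ^ 2) ^ i)" .
    moreover have "(1 - X) * (1 + X) \<noteq> 0" using False by (simp add: add_eq_0_iff)
    ultimately show ?thesis by (simp only: mult_cancel_left) simp
  qed
  \<comment> \<open>The norm of a geometric sum is the quotient of \<open>1 - (Y\<^sup>p)\<^sup>x\<close> by \<open>1 - Y\<^sup>x\<close>.\<close>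
  have "(1 - ?Y ^ x) * (\<Prod>k<x. \<Sum>i<p. ?y k ^ i) = (\<Prod>k<x. (1 - ?y k) * (\<Sum>i<p. ?y k ^ i))"
    by (simp add: prod_zeta_pow_poly[OF coprime_2_x, symmetric] prod.distrib)
  also have "\<dots> = (\<Prod>k<x. 1 - smult (zeta_pow (int (2 * p) * int k)) (?Y ^ p))"
  proof (rule prod.cong[OF refl])
    fix k
    have "?y k ^ p = smult (zeta_pow (int (2 * p) * int k)) (?Y ^ p)"
      by (simp only: smult_power zeta_pow_power of_nat_mult of_nat_numeral mult_ac)
    then show "(1 - ?y k) * (\<Sum>i<p. ?y k ^ i) = 1 - smult (zeta_pow (int (2 * p) * int k)) (?Y ^ p)"
      using one_diff_power_eq[of "?y k" p] by simp
  qed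
  also have "\<dots> = 1 - (?Y ^ p) ^ x"
    using p(3) odd_x by (intro prod_zeta_pow_poly) (simp only: coprime_int_iff, simp)
  also have "\<dots> = (1 - ?Y ^ x) * (\<Sum>i<p. (?Y ^ x) ^ i)"
  proof -
    have "(?Y ^ p) ^ x = (?Y ^ x) ^ p" by (simp only: power_mult[symmetric] mult.commute)
    then show ?thesis using one_diff_power_eq[of "?Y ^ x" p] by simp
  qed
  finally have "(1 - ?Y ^ x) * (\<Prod>k<x. \<Sum>i<p. ?y k ^ i) = (1 - ?Y ^ x) * (\<Sum>i<p. (?Y ^ x) ^ i)" .
  moreover have "1 - ?Y ^ x \<noteq> 0"
  proof
    assume "1 - ?Y ^ x = 0"
    then have "poly (1 - ?Y ^ x) 0 = 0" by simp
    then show False using x_pos by (simp add: Y_def poly_monom map_poly_monom power_0_left)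
  qed
  ultimately have "(\<Sum>i<p. (?Y ^ x) ^ i) = (\<Prod>k<x. \<Sum>i<p. ?y k ^ i)" by simp
  then have B: "of_int_poly (\<Sum>i<p. (Y ^ x) ^ i) = (\<Prod>k<x. \<Sum>i<p. ?y k ^ i)"
    by (simp add: hom_distribs)
  have "\<exists>E. D * ?D' * E = (\<Sum>i<p. (Y ^ x) ^ i)"
  proof (rule aurifeuillian_factorization[where \<theta> = "\<lambda>X. \<Sum>i<p. X ^ i" and \<beta> = "\<lambda>X. \<Sum>i<p. X ^ i", OF split _ _ D(1,2) B])
    show "pcompose (\<Sum>i<p. X ^ i) q = (\<Sum>i<p. pcompose X q ^ i)" for X q :: "complex poly"
      by (simp add: pcompose_sum pcompose_hom.hom_power)
    show "(\<Sum>i<p. (0 :: complex poly) ^ i) = 1"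
      using p(2) by (simp add: power_0_left)
  qed
  moreover have "coeff ?D' 0 = 1" using D(2) by (simp add: poly_pcompose flip: poly_0_coeff_0)
  moreover have "coeff ?D' 1 = - coeff D 1"
    unfolding coeff_1_eq_pderiv by (simp add: pderiv_pcompose poly_pcompose pderiv_pCons)
  ultimately show ?thesis using D by (metis even_minus)
qed

end

section \<open>Common prime factors of values\<close>

lemma poly_at_2_mod_4:
  fixes D :: "int poly"
  assumes "coeff D 0 = 1" "odd (coeff D 1)"
  shows "poly D 2 mod 4 = 3"
proof -
  obtain c0 D1 where D: "D = pCons c0 D1" by (cases D)
  obtain c1 D2 where D1: "D1 = pCons c1 D2" by (cases D1)
  have "c0 = 1" "odd c1" using assms by (simp_all add: D D1)
  then have "poly D 2 = 1 + 2 * c1 + 4 * poly D2 2" by (simp add: D D1)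
  then show ?thesis using \<open>odd c1\<close> by presburger
qed

text \<open>The factor has no real root and is 1 at 0, so it cannot become negative.\<close>

lemma factor_pos_of_product_pos:
  fixes D K B :: "int poly"
  assumes "D * K = B" "coeff D 0 = 1" and pos: "\<And>t :: real. poly (of_int_poly B) t > 0"
  shows "poly D 2 > 0"
proof (rule ccontr)
  assume "\<not> poly D 2 > 0"
  let ?D = "of_int_poly D :: real poly"
  have nz: "poly ?D t \<noteq> 0" for t
    using pos[of t] unfolding assms(1)[symmetric] by (auto simp: hom_distribs)
  have "poly ?D (of_int 2) = of_int (poly D 2)" by (rule of_int_hom.poly_map_poly)
  then have "poly ?D 2 < 0" using \<open>\<not> poly D 2 > 0\<close> nz[of 2] by simp
  moreover have "poly ?D 0 = 1" using assms(2) by (simp add: poly_0_coeff_0 coeff_map_poly)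
  ultimately show False using poly_IVT_neg[of 0 2 ?D] nz by auto
qed

lemma dvd_geometric_sum:
  fixes y q :: int
  assumes "q dvd 1 - y" "q dvd (\<Sum>i<n. y ^ i)"
  shows "q dvd int n"
proof -
  have "[y = 1] (mod q)" using assms(1) by (simp add: cong_iff_dvd_diff dvd_diff_commute)
  then have "[(\<Sum>i<n. y ^ i) = (\<Sum>i<n. 1 ^ i)] (mod q)" by (intro cong_sum cong_pow)
  then show ?thesis using assms(2) cong_dvd_iff by fastforce
qed

text \<open>Write \<open>y = 1 - pt\<close>. Modulo \<open>p\<^sup>2\<close> the sum is \<open>p - pt (0 + 1 + \<dots> + (p - 1))\<close>, and the inner sum is
  divisible by \<open>p\<close> because \<open>p\<close> is odd. So the whole sum is congruent to \<open>p\<close>.\<close>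

lemma prime_square_not_dvd_geometric_sum:
  fixes y :: int
  assumes p: "prime p" "p > 2" and dvd: "int p dvd 1 - y"
  shows "\<not> (int p)\<^sup>2 dvd (\<Sum>i<p. y ^ i)"
proof
  assume A: "(int p)\<^sup>2 dvd (\<Sum>i<p. y ^ i)"
  from dvd obtain t where "1 - y = int p * t" by blast
  then have y: "y = 1 - int p * t" by simp
  have "[y ^ i = 1 - int i * (int p * t)] (mod (int p)\<^sup>2)" for i
  proof (induct i)
    case (Suc i)
    have "[y * y ^ i = y * (1 - int i * (int p * t))] (mod (int p)\<^sup>2)"
      by (intro cong_mult Suc cong_refl)
    also have "y * (1 - int i * (int p * t)) =
        (1 - int (Suc i) * (int p * t)) + (int p)\<^sup>2 * (int i * t\<^sup>2)"
      unfolding y by (simp add: algebra_simps power2_eq_square)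
    also have "[\<dots> = 1 - int (Suc i) * (int p * t)] (mod (int p)\<^sup>2)"
      by (simp add: cong_def)
    finally show ?case by simp
  qed simp
  then have "[(\<Sum>i<p. y ^ i) = (\<Sum>i<p. 1 - int i * (int p * t))] (mod (int p)\<^sup>2)"
    by (intro cong_sum)
  then have "(int p)\<^sup>2 dvd (\<Sum>i<p. 1 - int i * (int p * t))" using A cong_dvd_iff by blast
  moreover have "(\<Sum>i<p. 1 - int i * (int p * t)) = int p - (\<Sum>i<p. int i) * (int p * t)"
    by (simp add: sum_subtractf sum_distrib_right)
  moreover have "(int p)\<^sup>2 dvd (\<Sum>i<p. int i) * (int p * t)"
  proof -
    obtain m where m: "p = 2 * m + 1" using p prime_odd_nat oddE by blast
    have "2 * (\<Sum>i<n. int i) = int n * (int n - 1)" for n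
      by (induct n) (simp_all add: algebra_simps)
    from this[of p] have "(\<Sum>i<p. int i) = int p * int m" by (simp add: m algebra_simps)
    then show ?thesis by (simp add: power2_eq_square)
  qed
  ultimately have "(int p)\<^sup>2 dvd
      (int p - (\<Sum>i<p. int i) * (int p * t)) + (\<Sum>i<p. int i) * (int p * t)"
    by (intro dvd_add) simp_all
  then have "(int p)\<^sup>2 dvd int p" by simp
  then have "int p dvd 1" using p(2) by (simp add: power2_eq_square)
  then show False using p(2) by simp
qed

context aurifeuillian_modulus
begin

lemma poly_Y_2: "poly Y 2 = - 4 * int x"
  by (simp add: Y_def poly_monom)

text \<open>Here \<open>D\<close> and \<open>K\<close> are cofactors inside \<open>1 - Y\<^sup>n\<close>. If a prime divides both at \<open>s = 2\<close>, it divides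
  the derivative of \<open>1 - Y\<^sup>n\<close> there, which is \<open>n\<close> times a power of \<open>-4x\<close>.\<close>

lemma common_prime_factor:
  fixes q :: int
  assumes fact: "D * K * C = 1 - Y ^ n" and q: "prime q" "q dvd poly D 2" and n: "n > 0"
  shows "\<not> q dvd 4 * int x" and "q dvd poly K 2 \<Longrightarrow> q dvd int n"
proof -
  have eq: "poly D 2 * poly K 2 * poly C 2 = 1 - (- 4 * int x) ^ n"
    using arg_cong[OF fact, of "\<lambda>p. poly p 2"] by (simp add: poly_Y_2)
  have dvd: "q dvd 1 - (- 4 * int x) ^ n"
    unfolding eq[symmetric] using q(2) by (intro dvd_mult2)
  show nd: "\<not> q dvd 4 * int x"
  proof
    assume "q dvd 4 * int x"
    then have "q dvd - 4 * int x" by simp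
    then have "q dvd (- 4 * int x) ^ n" using n dvd_power dvd_trans by blast
    then have "q dvd (1 - (- 4 * int x) ^ n) + (- 4 * int x) ^ n" using dvd by (rule dvd_add[rotated])
    then have "is_unit q" by simp
    then show False using q(1) not_prime_unit by blast
  qed
  assume qK: "q dvd poly K 2"
  have "poly (pderiv (D * K * C)) 2 = poly (pderiv (1 - Y ^ n)) 2" by (simp only: fact)
  moreover have "q dvd poly (pderiv (D * K * C)) 2"
    using q(2) qK by (simp add: pderiv_mult)
  moreover have "poly (pderiv (1 - Y ^ n)) 2 = - (int n * (- 4 * int x) ^ n)"
  proof -
    obtain m where m: "n = Suc m" using n gr0_implies_Suc by blast
    have "poly (pderiv Y) 2 = - 4 * int x" by (simp add: Y_def pderiv_monom poly_monom)
    then show ?thesis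
      by (simp add: m pderiv_diff pderiv_power_Suc poly_Y_2 algebra_simps del: power_Suc)
        (simp add: algebra_simps)
  qed
  ultimately have "q dvd int n * (- 4 * int x) ^ n" by simp
  moreover have "\<not> q dvd (- 4 * int x) ^ n"
    using nd prime_dvd_power[OF q(1), of "- 4 * int x" n] by auto
  ultimately show "q dvd int n" using q(1) prime_dvd_mult_iff by blast
qed

section \<open>Unitary divisors that are 3 modulo 4\<close>

lemma Y_power_x_nonpos: "poly (of_int_poly (Y ^ x)) (t :: real) \<le> 0"
proof -
  have "poly (of_int_poly Y) t \<le> 0" by (simp add: Y_def map_poly_monom poly_monom)
  then have "poly (of_int_poly Y) t ^ x \<le> 0" using odd_x by (simp add: power_le_zero_eq odd_pos)
  then show ?thesis by (simp add: hom_distribs)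
qed

text \<open>The criterion by which both cases are settled. The multiplier \<open>M\<close> collects the part of
  \<open>1 - y\<^sup>n\<close> that lies outside the value at \<open>s = 2\<close> of the factored polynomial.\<close>

lemma sum_of_squares_contradiction:
  assumes D: "D * K = B" "coeff D 0 = 1" "odd (coeff D 1)"
    and pos: "\<And>t :: real. poly (of_int_poly B) t > 0"
    and cop: "\<And>q :: int. prime q \<Longrightarrow> q dvd poly D 2 \<Longrightarrow> \<not> q dvd poly K 2 * M"
  shows "\<not> sum_of_two_squares (poly B 2 * M)"
proof
  assume "sum_of_two_squares (poly B 2 * M)"
  then obtain s t where st: "poly D 2 * (poly K 2 * M) = s\<^sup>2 + t\<^sup>2"
    unfolding sum_of_two_squares_def by (auto simp: D(1)[symmetric] mult.assoc)
  have "poly D 2 > 0" by (rule factor_pos_of_product_pos[OF D(1,2) pos])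
  moreover have "coprime (poly D 2) (poly K 2 * M)"
  proof (rule ccontr)
    assume "\<not> coprime (poly D 2) (poly K 2 * M)"
    then have "\<not> is_unit (gcd (poly D 2) (poly K 2 * M))"
      by (simp only: is_unit_gcd not_False_eq_True)
    moreover have "gcd (poly D 2) (poly K 2 * M) \<noteq> 0" using \<open>poly D 2 > 0\<close> by simp
    ultimately obtain q where "prime q" "q dvd gcd (poly D 2) (poly K 2 * M)"
      using prime_divisor_exists by blast
    then show False using cop[of q] by simp
  qed
  ultimately have "poly D 2 mod 4 \<noteq> 3" using unitary_divisor_of_sum_of_squares[OF st] by blast
  then show False using poly_at_2_mod_4[OF D(2,3)] by simp
qed

text \<open>The divisor of \<open>1 - y\<close> stays unitary in \<open>1 - y\<^sup>n\<close>: a prime dividing both \<open>1 - y\<close> and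
  \<open>(1 - y\<^sup>n) / (1 - y)\<close> divides \<open>n\<close>, hence \<open>x\<close>, whereas \<open>1 - y\<close> is coprime to \<open>x\<close>.\<close>

lemma not_sum_of_squares_if_primes_dvd_x:
  assumes n: "n > 0" "\<And>r. prime r \<Longrightarrow> r dvd n \<Longrightarrow> r dvd x"
  shows "\<not> sum_of_two_squares (1 - ((- 4 * int x) ^ x) ^ n)"
proof -
  obtain D K :: "int poly" where D: "D * K = 1 - Y ^ x" "coeff D 0 = 1" "odd (coeff D 1)"
    using factor_one_minus_Y_power_x by blast
  define y where "y = (- 4 * int x) ^ x"
  have B2: "poly (1 - Y ^ x) 2 = 1 - y" by (simp add: y_def poly_Y_2)
  have "\<not> sum_of_two_squares (poly (1 - Y ^ x) 2 * (\<Sum>i<n. y ^ i))"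
  proof (rule sum_of_squares_contradiction[OF D])
    show "poly (of_int_poly (1 - Y ^ x)) t > 0" for t :: real
      using Y_power_x_nonpos[of t] by (simp add: hom_distribs)
    fix q :: int assume q: "prime q" "q dvd poly D 2"
    have fact: "D * K * 1 = 1 - Y ^ x" using D(1) by simp
    have nd: "\<not> q dvd 4 * int x" by (rule common_prime_factor(1)[OF fact q x_pos])
    have "\<not> q dvd poly K 2"
      using common_prime_factor(2)[OF fact q x_pos] nd by auto
    moreover have "\<not> q dvd (\<Sum>i<n. y ^ i)"
    proof
      assume "q dvd (\<Sum>i<n. y ^ i)"
      moreover have "q dvd 1 - y"
        using q(2) B2 unfolding D(1)[symmetric] by (metis dvd_mult2 poly_mult)
      ultimately have "q dvd int n" using dvd_geometric_sum by blast
      moreover obtain r where r: "q = int r" using q(1) prime_ge_0_int nonneg_int_cases by metis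
      ultimately have "r dvd x" using n(2)[of r] q(1) by simp
      then show False using nd r by simp
    qed
    ultimately show "\<not> q dvd poly K 2 * (\<Sum>i<n. y ^ i)" using q(1) prime_dvd_mult_iff by blast
  qed
  then show ?thesis unfolding B2 one_diff_power_eq[symmetric] y_def .
qed

text \<open>The value of \<open>D\<close> at 2 is the unitary divisor. Let \<open>q\<close> be one of its primes, different from \<open>p\<close>.
  The three parts of the complementary divisor are excluded in turn: the cofactor \<open>K\<close> by the derivative argument, \<open>1 - y\<close>
  because it shares at most the prime \<open>p\<close> with the geometric sum, and the remaining sum because \<open>q\<close>
  would divide \<open>n/p\<close>. In the last case the maximality of \<open>p\<close> gives \<open>q < p\<close>, so that \<open>p\<close> and
  \<open>q - 1\<close> are coprime and \<open>y\<^sup>p = 1\<close> forces \<open>y = 1\<close> modulo \<open>q\<close>.\<close>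

lemma not_sum_of_squares_if_coprime_factor:
  assumes D: "D * K = (\<Sum>i<p. (Y ^ x) ^ i)" "coeff D 0 = 1" "odd (coeff D 1)"
    and p: "prime p" "p > 2" "\<not> p dvd x" "\<not> int p dvd poly D 2"
    and n: "n = p * m" "odd n"
    and largest: "\<And>r. prime r \<Longrightarrow> r dvd n \<Longrightarrow> \<not> r dvd x \<Longrightarrow> r \<le> p"
  shows "\<not> sum_of_two_squares (1 - ((- 4 * int x) ^ x) ^ n)"
proof -
  let ?B = "\<Sum>i<p. (Y ^ x) ^ i"
  define y where "y = (- 4 * int x) ^ x"
  define M where "M = (1 - y) * (\<Sum>i<m. (y ^ p) ^ i)"
  have B2: "poly ?B 2 = (\<Sum>i<p. y ^ i)" by (simp add: y_def poly_sum poly_Y_2)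
  have fact: "D * K * (1 - Y ^ x) = 1 - Y ^ (x * p)"
    unfolding D(1) power_mult one_diff_power_eq[of "Y ^ x" p] by (rule mult.commute)
  have xp: "x * p > 0" using x_pos p(2) by simp
  have "\<not> sum_of_two_squares (poly ?B 2 * M)"
  proof (rule sum_of_squares_contradiction[OF D])
    fix t :: real
    let ?w = "poly (of_int_poly (Y ^ x)) t"
    have "odd p" using p prime_odd_nat by blast
    then have "?w ^ p \<le> 0" using Y_power_x_nonpos[of t] by (simp add: power_le_zero_eq odd_pos)
    then have "(1 - ?w) * (\<Sum>i<p. ?w ^ i) > 0" using one_diff_power_eq[of ?w p] by simp
    moreover have "1 - ?w > 0" using Y_power_x_nonpos[of t] by simp
    ultimately have "(\<Sum>i<p. ?w ^ i) > 0" by (simp only: zero_less_mult_pos)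
    then show "poly (of_int_poly ?B) t > 0" by (simp add: hom_distribs poly_sum)
  next
    fix q :: int assume q: "prime q" "q dvd poly D 2"
    obtain r where r: "q = int r" using q(1) prime_ge_0_int nonneg_int_cases by metis
    have pr: "prime r" using q(1) r by simp
    have rp: "r \<noteq> p" using q(2) r p(4) by auto
    have nd: "\<not> q dvd 4 * int x" by (rule common_prime_factor(1)[OF fact q xp])
    then have rx: "\<not> r dvd x" using r by auto
    have "r \<noteq> 2" using nd r by auto
    then have r2: "r > 2" using prime_ge_2_nat[OF pr] by simp
    have qG: "q dvd (\<Sum>i<p. y ^ i)"
      using q(2) unfolding B2[symmetric] D(1)[symmetric] by simp
    have "\<not> q dvd poly K 2"
    proof
      assume "q dvd poly K 2"
      then have "r dvd x * p" using common_prime_factor(2)[OF fact q xp] r by (simp flip: of_nat_mult)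
      then show False using pr p(1) rx rp by (auto simp: prime_dvd_mult_iff primes_dvd_imp_eq)
    qed
    moreover have n1: "\<not> q dvd 1 - y"
    proof
      assume "q dvd 1 - y"
      then have "r dvd p" using dvd_geometric_sum[OF _ qG] r by simp
      then show False using rp pr p(1) primes_dvd_imp_eq by blast
    qed
    moreover have "\<not> q dvd (\<Sum>i<m. (y ^ p) ^ i)"
    proof
      assume A: "q dvd (\<Sum>i<m. (y ^ p) ^ i)"
      have "1 - y ^ p = (1 - y) * (\<Sum>i<p. y ^ i)" by (rule one_diff_power_eq)
      then have yp: "q dvd 1 - y ^ p" using qG by simp
      then have "r dvd m" using dvd_geometric_sum[OF yp A] r by simp
      then have "r \<le> p" using largest[OF pr] rx n by simp
      then have "r < p" using rp by simp
      have "coprime p (r - 1)"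
        using p(1) \<open>r < p\<close> r2 by (intro prime_imp_coprime) (auto dest: dvd_imp_le)
      moreover have r1: "r - 1 \<noteq> 1" using r2 by simp
      ultimately obtain a b where ab: "p * a = (r - 1) * b + 1"
        using coprime_bezout_strong[of p "r - 1"] r1 by blast
      have "\<not> q dvd - 4 * int x" using nd by simp
      then have "\<not> int r dvd y" unfolding y_def r[symmetric] using prime_dvd_power[OF q(1)] by blast
      from fermat_int[OF pr r2 this]
      have "[(y ^ (r - 1)) ^ b * y = 1 ^ b * y] (mod q)"
        unfolding r by (intro cong_mult cong_pow) auto
      also have "(y ^ (r - 1)) ^ b * y = (y ^ p) ^ a"
        by (simp only: power_mult[symmetric] ab power_add power_one_right)
      finally have "[y = (y ^ p) ^ a] (mod q)" by (simp add: cong_sym_eq)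
      also have "[y ^ p = 1] (mod q)" using yp by (simp add: cong_iff_dvd_diff dvd_diff_commute)
      then have "[(y ^ p) ^ a = 1 ^ a] (mod q)" by (rule cong_pow)
      finally show False using n1 by (simp add: cong_iff_dvd_diff dvd_diff_commute)
    qed
    ultimately show "\<not> q dvd poly K 2 * M"
      unfolding M_def using q(1) prime_dvd_mult_iff by blast
  qed
  moreover have "poly ?B 2 * M = 1 - y ^ n"
  proof -
    have "poly ?B 2 * M = ((1 - y) * (\<Sum>i<p. y ^ i)) * (\<Sum>i<m. (y ^ p) ^ i)"
      unfolding B2 M_def by (simp only: mult_ac)
    also have "(1 - y) * (\<Sum>i<p. y ^ i) = 1 - y ^ p" by (rule one_diff_power_eq[symmetric])
    also have "(1 - y ^ p) * (\<Sum>i<m. (y ^ p) ^ i) = 1 - (y ^ p) ^ m" by (rule one_diff_power_eq[symmetric])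
    finally show ?thesis by (simp add: n(1) power_mult)
  qed
  ultimately show ?thesis unfolding y_def by simp
qed

text \<open>Of the two Aurifeuillian factors only one can be divisible by \<open>p\<close>: the square of \<open>p\<close> does not
  divide the geometric sum, which contains their product.\<close>

lemma not_sum_of_squares_if_prime_not_dvd_x:
  assumes p: "prime p" "p dvd n" "\<not> p dvd x" and n: "odd n"
    and largest: "\<And>r. prime r \<Longrightarrow> r dvd n \<Longrightarrow> \<not> r dvd x \<Longrightarrow> r \<le> p"
  shows "\<not> sum_of_two_squares (1 - ((- 4 * int x) ^ x) ^ n)"
proof -
  obtain m where m: "n = p * m" using p(2) by blast
  have "odd p" using p(2) n by auto
  then have p2: "p > 2" using prime_ge_2_nat[OF p(1)] by (cases "p = 2") auto
  have cop: "coprime p x" using p(1,3) prime_imp_coprime by blast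
  obtain D D' E :: "int poly" where D: "D * D' * E = (\<Sum>i<p. (Y ^ x) ^ i)"
      "coeff D 0 = 1" "odd (coeff D 1)" "coeff D' 0 = 1" "odd (coeff D' 1)"
    using factor_geometric_sum[OF \<open>odd p\<close> _ cop] p2 by auto
  define y where "y = (- 4 * int x) ^ x"
  have B2: "poly D 2 * poly D' 2 * poly E 2 = (\<Sum>i<p. y ^ i)"
    using arg_cong[OF D(1), of "\<lambda>P. poly P 2"] by (simp add: y_def poly_sum poly_Y_2)
  have "\<not> (int p dvd poly D 2 \<and> int p dvd poly D' 2)"
  proof
    assume A: "int p dvd poly D 2 \<and> int p dvd poly D' 2"
    then have sq: "(int p)\<^sup>2 dvd (\<Sum>i<p. y ^ i)"
      unfolding B2[symmetric] power2_eq_square by (intro dvd_mult2 mult_dvd_mono) auto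
    then have "int p dvd (\<Sum>i<p. y ^ i)" by (metis dvd_mult_left power2_eq_square)
    then have "int p dvd 1 - y ^ p" unfolding one_diff_power_eq by simp
    then have "[1 = y ^ p] (mod int p)" by (simp add: cong_iff_dvd_diff)
    also have "\<not> int p dvd y"
    proof
      assume "int p dvd y"
      then have "int p dvd - 4 * int x"
        unfolding y_def using prime_dvd_power[of "int p" "- 4 * int x" x] p(1) by simp
      then have "int p dvd int 4 * int x" by simp
      then have "p dvd 2 ^ 2 * x" unfolding of_nat_mult[symmetric] int_dvd_int_iff by simp
      then have "p dvd 2" using p(1,3) prime_dvd_mult_iff prime_dvd_power by blast
      then show False using p2 by (auto dest: dvd_imp_le)
    qed
    from cong_mult[OF fermat_int[OF p(1) p2 this] cong_refl[of y]]
    have "[y ^ p = y] (mod int p)" using p2 by (simp flip: power_Suc2)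
    finally have "int p dvd 1 - y" by (simp add: cong_iff_dvd_diff)
    from prime_square_not_dvd_geometric_sum[OF p(1) p2 this] sq show False by blast
  qed
  then consider "\<not> int p dvd poly D 2" | "\<not> int p dvd poly D' 2" by blast
  then show ?thesis
  proof cases
    case 1
    have "D * (D' * E) = (\<Sum>i<p. (Y ^ x) ^ i)" using D(1) by (simp add: mult_ac)
    from not_sum_of_squares_if_coprime_factor[OF this D(2,3) p(1) p2 p(3) 1 m n largest] show ?thesis .
  next
    case 2
    have "D' * (D * E) = (\<Sum>i<p. (Y ^ x) ^ i)" using D(1) by (simp add: mult_ac)
    from not_sum_of_squares_if_coprime_factor[OF this D(4,5) p(1) p2 p(3) 2 m n largest] show ?thesis .
  qed
qed

end

theorem theorem1p3:
  fixes x a n :: nat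
  assumes "x > 0"
    and "squarefree x"
    and "[x = 3] (mod 4)"
    and "a = 4 * x"
    and "n > 0"
    and "odd n"
  shows "\<not> sum_of_two_squares (int a ^ (n * x) + 1)"
proof -
  interpret aurifeuillian_modulus x
    using assms(2,3) by unfold_locales (simp_all add: cong_def)
  have "\<not> sum_of_two_squares (1 - ((- 4 * int x) ^ x) ^ n)"
  proof (cases "\<forall>r. prime r \<longrightarrow> r dvd n \<longrightarrow> r dvd x")
    case True
    then show ?thesis using not_sum_of_squares_if_primes_dvd_x assms(5) by blast
  next
    case False
    define S where "S = {r. prime r \<and> r dvd n \<and> \<not> r dvd x}"
    have "S \<subseteq> {..n}" using assms(5) by (auto simp: S_def dvd_imp_le)
    then have fin: "finite S" using finite_subset by blast
    have "S \<noteq> {}" using False by (auto simp: S_def)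
    then have "Max S \<in> S" using fin Max_in by blast
    moreover have "r \<le> Max S" if "prime r" "r dvd n" "\<not> r dvd x" for r
      using that fin by (intro Max_ge) (auto simp: S_def)
    ultimately show ?thesis using not_sum_of_squares_if_prime_not_dvd_x[of "Max S" n] assms(6) by (auto simp: S_def)
  qed
  moreover have "1 - ((- 4 * int x) ^ x) ^ n = int a ^ (n * x) + 1"
  proof -
    have "odd (x * n)" using odd_x assms(6) by simp
    then have "(- (4 * int x)) ^ (x * n) = - ((4 * int x) ^ (x * n))" by (rule power_minus_odd)
    then show ?thesis by (simp add: assms(4) mult.commute flip: power_mult)
  qed
  ultimately show ?thesis by (simp only: not_False_eq_True)
qed

end
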